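(* Let $A\in\mathbb{R}^{n\times d}$ be a nonzero matrix with rows $a_1,\dots,a_n$, let $f(x)=\frac1{2n}\|Ax-b\|_2^2$, and let $\bar S=[S_1,\dots,S_K]$ be a partition of $[n]=\{1,\dots,n\}$ into $K$ disjoint subsets of equal size $m=n/K$. Let $\rho\in[1,n]$ satisfy $$\frac{\max_{i\in[n]}\|a_i\|_2^2}{\frac1n\sum_{j=1}^n\|a_j\|_2^2}\le\rho .$$ Then the Stochastic Acceleration factor $\Upsilon(A,\bar S,K)$ satisfies $$\Upsilon(A,\bar S,K)\;\ge\;\frac{\|A\|^2}{\mu_\ell(A,\bar S,K)}\;\ge\;\frac{K\|A\|^2}{n\|A^T\|_{1\to2}^2}\;\ge\;\frac{K\cdot\sigma(A^TA,1)}{\rho\cdot\sum_{i=1}^d\sigma(A^TA,i)} .$$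
   Context: $\|A\|$ is the spectral norm of $A$; $\|A^T\|_{1\to2}^2:=\max_{i\in[n]}\|a_i\|_2^2$; $\sigma(H,k)$ denotes the $k$-th largest eigenvalue of a symmetric matrix $H$. Let $S^k$ be the row-subsampling operator supported on $S_k$ (so $S^kA$ is the submatrix of $A$ with rows indexed by $S_k$), and $f_{S_k}(x)=\frac{K}{2n}\|S^kAx-S^kb\|_2^2$, so that $f=\frac1K\sum_{k=1}^Kf_{S_k}$. $L_f$ is the gradient-Lipschitz (smoothness) constant of $f$ and $L_b$ is the common gradient-Lipschitz constant of the $f_{S_k}$, i.e. in the least-squares setting $$L_f=\frac1n\|A\|^2,\qquad L_b=\frac Kn\max_{k\in[K]}\|S^kA(S^kA)^T\| .$$ The Stochastic Acceleration (SA) factor is $\Upsilon(A,\bar S,K)=\frac{KL_f}{L_b}$. The local-accumulated-coherence is $$\mu_\ell(A,\bar S,K)=\max_{q\in[K]}\max_{j\in S_q}\sum_{k\in S_q}|\langle a_j,a_k\rangle| .$$ *)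

theory Defs
  imports
    "HOL-Analysis.Analysis"
    "HOL-Computational_Algebra.Polynomial"
begin

section \<open>Matrix quantities\<close>

definition spectral_norm :: "real^'m^'n \<Rightarrow> real" where
  "spectral_norm A = onorm (\<lambda>x. A *v x)"

text \<open>The square of the norm of \<open>A\<^sup>T\<close> from \<open>\<ell>\<^sub>1\<close> to \<open>\<ell>\<^sub>2\<close>.\<close>

definition sq_norm_transpose_1_to_2 :: "real^'d^'n \<Rightarrow> real" where
  "sq_norm_transpose_1_to_2 A = (MAX i\<in>UNIV. (norm (row i A))\<^sup>2)"

definition charpoly :: "real^'n^'n \<Rightarrow> real poly" where
  "charpoly H = det (\<chi> i j. (if i = j then [:0, 1:] else 0) - [:H $ i $ j:])"

text \<open>
  Eigenvalues are counted with multiplicity. A symmetric real matrix of size \<open>d\<close> has exactly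
  \<open>d\<close> real ones, so that \<open>eigval_desc H k\<close> is meaningful for \<open>1 \<le> k \<le> d\<close>.
\<close>

definition eigval_desc :: "real^'n^'n \<Rightarrow> nat \<Rightarrow> real" where
  "eigval_desc H k = rev (sorted_list_of_multiset (proots (charpoly H))) ! (k - 1)"

section \<open>Smoothness constants\<close>

definition is_smooth :: "real \<Rightarrow> (real^'d \<Rightarrow> real) \<Rightarrow> bool" where
  "is_smooth L f \<longleftrightarrow> (\<exists>g. (\<forall>x. GDERIV f x :> g x) \<and> L-lipschitz_on UNIV g)"

definition smooth_const :: "(real^'d \<Rightarrow> real) \<Rightarrow> real" where
  "smooth_const f = Inf {L. is_smooth L f}"

definition common_smooth_const :: "'k set \<Rightarrow> ('k \<Rightarrow> real^'d \<Rightarrow> real) \<Rightarrow> real" where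
  "common_smooth_const I f = Inf {L. \<forall>k\<in>I. is_smooth L (f k)}"

section \<open>Least squares with minibatches\<close>

definition least_squares :: "real^'d^'n \<Rightarrow> real^'n \<Rightarrow> real^'d \<Rightarrow> real" where
  "least_squares A b x = 1 / (2 * real CARD('n)) * (norm (A *v x - b))\<^sup>2"

text \<open>
  Row subsampling: the entries (of a vector) or rows (of a matrix) whose index lies in \<open>S\<close>,
  re-indexed by a type \<open>'m\<close> with \<open>card S = CARD('m)\<close>. The enumeration of \<open>S\<close> is arbitrary, but
  it is the same one for \<open>A\<close> and \<open>b\<close>.
\<close>

definition subsample :: "'n set \<Rightarrow> 'a^'n \<Rightarrow> 'a^'m" where
  "subsample S v = (\<chi> j. v $ (SOME e. bij_betw e (UNIV :: 'm set) S) j)"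

text \<open>The first argument fixes the index type of the minibatches, hence their common size.\<close>

definition batch_loss ::
  "'m::finite itself \<Rightarrow> real^'d^'n \<Rightarrow> real^'n \<Rightarrow> (nat \<Rightarrow> 'n set) \<Rightarrow> nat \<Rightarrow> nat \<Rightarrow> real^'d \<Rightarrow> real" where
  "batch_loss _ A b S K k x = real K / (2 * real CARD('n)) *
     (norm ((subsample (S k) A :: real^'d^'m) *v x - subsample (S k) b))\<^sup>2"

definition SA_factor ::
  "'m::finite itself \<Rightarrow> real^'d^'n \<Rightarrow> real^'n \<Rightarrow> (nat \<Rightarrow> 'n set) \<Rightarrow> nat \<Rightarrow> real" where
  "SA_factor m A b S K =
     real K * smooth_const (least_squares A b)
       / common_smooth_const {1..K} (batch_loss m A b S K)"

definition local_coherence :: "real^'d^'n \<Rightarrow> (nat \<Rightarrow> 'n set) \<Rightarrow> nat \<Rightarrow> real" where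
  "local_coherence A S K =
     (MAX q\<in>{1..K}. MAX j\<in>S q. \<Sum>k\<in>S q. \<bar>row j A \<bullet> row k A\<bar>)"

definition equipartition :: "'m::finite itself \<Rightarrow> (nat \<Rightarrow> 'n::finite set) \<Rightarrow> nat \<Rightarrow> bool" where
  "equipartition _ S K \<longleftrightarrow>
     disjoint_family_on S {1..K} \<and> (\<Union>k\<in>{1..K}. S k) = UNIV \<and>
     (\<forall>k\<in>{1..K}. card (S k) = CARD('m)) \<and> real CARD('m) = real CARD('n) / real K"

section \<open>Basic facts\<close>

lemma poly_det:
  fixes M :: "real poly^'n^'n"
  shows "poly (det M) x = det (\<chi> i j. poly (M $ i $ j) x)"
  by (simp add: det_def poly_sum poly_prod)

lemma poly_charpoly: "poly (charpoly H) x = det (mat x - H)"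
proof -
  have "(\<chi> i j. poly ((if i = j then [:0, 1:] else 0) - [:H $ i $ j:]) x) = mat x - H"
    by (simp add: vec_eq_iff mat_def)
  then show ?thesis by (simp add: charpoly_def poly_det)
qed

lemma charpoly_root_iff: "poly (charpoly H) x = 0 \<longleftrightarrow> (\<exists>v. v \<noteq> 0 \<and> H *v v = x *\<^sub>R v)"
proof -
  have m: "mat x *v v = x *\<^sub>R v" for v :: "real^'a"
    by (simp add: vec_eq_iff mat_def matrix_vector_mult_def if_distrib [of "\<lambda>a. a * _"]
        sum.delta cong: if_cong)
  have "det (mat x - H) = 0 \<longleftrightarrow> (\<exists>v. v \<noteq> 0 \<and> (mat x - H) *v v = 0)"
    using invertible_det_nz [of "mat x - H"] invertible_left_inverse [of "mat x - H"]
      matrix_left_invertible_ker [of "mat x - H"] by blast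
  also have "\<dots> \<longleftrightarrow> (\<exists>v. v \<noteq> 0 \<and> H *v v = x *\<^sub>R v)"
    by (auto simp: matrix_vector_mult_diff_rdistrib m)
  finally show ?thesis by (simp add: poly_charpoly)
qed

lemma norm_mult_le_spectral_norm: "norm (A *v x) \<le> spectral_norm A * norm x"
  unfolding spectral_norm_def by (rule onorm [OF matrix_vector_mul_bounded_linear])

lemma spectral_norm_nonneg: "0 \<le> spectral_norm A"
  unfolding spectral_norm_def by (rule onorm_pos_le [OF matrix_vector_mul_bounded_linear])

lemma inner_transpose: "(transpose A *v y) \<bullet> x = y \<bullet> (A *v (x :: real^'d))" for A :: "real^'d^'n"
  by (metis dot_lmul_matrix vector_transpose_matrix transpose_transpose)

lemma spectral_norm_transpose_le: "spectral_norm (transpose A) \<le> spectral_norm A"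
  for A :: "real^'d^'n"
  unfolding spectral_norm_def
proof (rule onorm_le)
  fix y :: "real^'n"
  let ?z = "transpose A *v y"
  have "norm ?z * norm ?z = y \<bullet> (A *v ?z)"
    using inner_transpose [of A y ?z] by (simp add: dot_square_norm power2_eq_square)
  also have "\<dots> \<le> norm y * norm (A *v ?z)" by (rule norm_cauchy_schwarz)
  also have "\<dots> \<le> norm y * (spectral_norm A * norm ?z)"
    by (intro mult_left_mono norm_mult_le_spectral_norm) auto
  finally have *: "norm ?z * norm ?z \<le> (onorm ((*v) A) * norm y) * norm ?z"
    by (simp add: spectral_norm_def mult_ac)
  show "norm ?z \<le> onorm ((*v) A) * norm y"
  proof (cases "?z = 0")
    case True
    then show ?thesis using spectral_norm_nonneg [of A] by (simp add: spectral_norm_def)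
  next
    case False
    then show ?thesis using * by simp
  qed
qed

lemma spectral_norm_transpose: "spectral_norm (transpose A) = spectral_norm A"
  by (metis antisym spectral_norm_transpose_le transpose_transpose)

lemma spectral_norm_gram: "spectral_norm (transpose A ** A) = (spectral_norm A)\<^sup>2"
  for A :: "real^'d^'n"
proof (rule antisym)
  have "norm ((transpose A ** A) *v x) \<le> (spectral_norm A)\<^sup>2 * norm x" for x
  proof -
    have "norm ((transpose A ** A) *v x) \<le> spectral_norm A * norm (A *v x)"
      using norm_mult_le_spectral_norm [of "transpose A" "A *v x"]
      by (simp add: spectral_norm_transpose flip: matrix_vector_mul_assoc)
    also have "\<dots> \<le> spectral_norm A * (spectral_norm A * norm x)"
      by (intro mult_left_mono norm_mult_le_spectral_norm spectral_norm_nonneg)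
    finally show ?thesis by (simp add: power2_eq_square mult_ac)
  qed
  then show "spectral_norm (transpose A ** A) \<le> (spectral_norm A)\<^sup>2"
    unfolding spectral_norm_def [of "transpose A ** A"] by (rule onorm_le)
next
  let ?s = "spectral_norm (transpose A ** A)"
  have "norm (A *v x) \<le> sqrt ?s * norm x" for x
  proof (rule power2_le_imp_le)
    have "(norm (A *v x))\<^sup>2 = ((transpose A ** A) *v x) \<bullet> x"
      using inner_transpose [of A "A *v x" x]
      by (simp add: dot_square_norm flip: matrix_vector_mul_assoc)
    also have "\<dots> \<le> norm ((transpose A ** A) *v x) * norm x" by (rule norm_cauchy_schwarz)
    also have "\<dots> \<le> (?s * norm x) * norm x"
      by (intro mult_right_mono norm_mult_le_spectral_norm) auto
    finally show "(norm (A *v x))\<^sup>2 \<le> (sqrt ?s * norm x)\<^sup>2"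
      by (simp add: power_mult_distrib spectral_norm_nonneg power2_eq_square mult_ac)
  qed (simp add: spectral_norm_nonneg)
  then have "spectral_norm A \<le> sqrt ?s"
    unfolding spectral_norm_def [of A] by (rule onorm_le)
  then have "(spectral_norm A)\<^sup>2 \<le> (sqrt ?s)\<^sup>2"
    by (intro power_mono spectral_norm_nonneg)
  then show "(spectral_norm A)\<^sup>2 \<le> ?s" by (simp add: spectral_norm_nonneg)
qed

lemma spectral_norm_gram': "spectral_norm (A ** transpose A) = (spectral_norm A)\<^sup>2"
  using spectral_norm_gram [of "transpose A"] by (simp add: spectral_norm_transpose)

lemma is_smooth_quadratic_iff:
  fixes B :: "real^'d^'m"
  assumes "c \<ge> 0"
  shows "is_smooth L (\<lambda>x. c / 2 * (norm (B *v x - b))\<^sup>2) \<longleftrightarrow> c * (spectral_norm B)\<^sup>2 \<le> L"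
proof -
  define f where "f = (\<lambda>x. c / 2 * (norm (B *v x - b))\<^sup>2)"
  define G where "G = (\<lambda>x. c *\<^sub>R (transpose B *v (B *v x - b)))"
  have fG: "GDERIV f x :> G x" for x
  proof -
    have "(f has_derivative (\<lambda>h. c * ((B *v x - b) \<bullet> (B *v h)))) (at x)"
      unfolding f_def power2_norm_eq_inner
      by (auto intro!: derivative_eq_intros bounded_linear_imp_has_derivative
          matrix_vector_mul_bounded_linear simp: inner_commute)
    moreover have "(\<lambda>h. c * ((B *v x - b) \<bullet> (B *v h))) = (\<lambda>h. h \<bullet> G x)"
      by (simp only: G_def fun_eq_iff inner_scaleR_right)
        (metis inner_commute inner_transpose)
    ultimately show ?thesis by (simp add: gderiv_def)
  qed
  have uniq: "g = G" if "\<forall>x. GDERIV f x :> g x" for g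
  proof
    fix x
    have "(\<lambda>h. h \<bullet> g x) = (\<lambda>h. h \<bullet> G x)"
      using that fG by (auto simp: gderiv_def intro: has_derivative_unique)
    then show "g x = G x" by (metis inner_commute vector_eq_ldot)
  qed
  have diff: "G x - G y = c *\<^sub>R ((transpose B ** B) *v (x - y))" for x y
    by (simp add: G_def algebra_simps flip: matrix_vector_mul_assoc)
  have "is_smooth L f \<longleftrightarrow> L-lipschitz_on UNIV G"
    unfolding is_smooth_def using fG uniq by metis
  also have "\<dots> \<longleftrightarrow> c * spectral_norm (transpose B ** B) \<le> L"
  proof
    assume L: "L-lipschitz_on UNIV G"
    have *: "norm (c *\<^sub>R ((transpose B ** B) *v x)) \<le> L * norm x" for x
      using lipschitz_on_normD [OF L, of x 0] diff [of x 0] by simp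
    have "onorm (\<lambda>x. c *\<^sub>R ((transpose B ** B) *v x)) \<le> L"
      using * by (rule onorm_le)
    then show "c * spectral_norm (transpose B ** B) \<le> L"
      using assms
      by (simp add: onorm_scaleR [OF matrix_vector_mul_bounded_linear] spectral_norm_def)
  next
    assume L: "c * spectral_norm (transpose B ** B) \<le> L"
    show "L-lipschitz_on UNIV G"
    proof (rule lipschitz_onI)
      show "0 \<le> L"
        using L assms spectral_norm_nonneg [of "transpose B ** B"]
        by (meson mult_nonneg_nonneg order_trans)
      fix x y
      have "dist (G x) (G y) = c * norm ((transpose B ** B) *v (x - y))"
        using assms by (simp add: dist_norm diff)
      also have "\<dots> \<le> c * (spectral_norm (transpose B ** B) * norm (x - y))"
        by (intro mult_left_mono norm_mult_le_spectral_norm assms)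
      also have "\<dots> \<le> L * norm (x - y)"
        using mult_right_mono [OF L, of "norm (x - y)"] by (simp add: mult_ac)
      finally show "dist (G x) (G y) \<le> L * dist x y" by (simp add: dist_norm)
    qed
  qed
  finally show ?thesis by (simp add: f_def spectral_norm_gram)
qed

lemma smooth_const_least_squares:
  "smooth_const (least_squares A b) = 1 / real CARD('n) * (spectral_norm A)\<^sup>2"
  for A :: "real^'d^'n"
proof -
  have "least_squares A b = (\<lambda>x. (1 / real CARD('n)) / 2 * (norm (A *v x - b))\<^sup>2)"
    by (simp add: least_squares_def fun_eq_iff)
  then have "{L. is_smooth L (least_squares A b)} = {1 / real CARD('n) * (spectral_norm A)\<^sup>2..}"
    using is_smooth_quadratic_iff [of "1 / real CARD('n)" _ A b] by (auto simp: atLeast_def)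
  then show ?thesis by (simp add: smooth_const_def)
qed

lemma common_smooth_const_batch_loss:
  fixes A :: "real^'d^'n"
  assumes "K \<ge> 1"
  shows "common_smooth_const {1..K} (batch_loss TYPE('m::finite) A b S K) =
    real K / real CARD('n) *
      (MAX k\<in>{1..K}. spectral_norm ((subsample (S k) A :: real^'d^'m) **
                                     transpose (subsample (S k) A :: real^'d^'m)))"
proof -
  let ?c = "real K / real CARD('n)"
  let ?N = "\<lambda>k. (spectral_norm (subsample (S k) A :: real^'d^'m))\<^sup>2"
  have c: "?c > 0" using assms by simp
  have "batch_loss TYPE('m) A b S K k =
      (\<lambda>x. ?c / 2 * (norm ((subsample (S k) A :: real^'d^'m) *v x - subsample (S k) b))\<^sup>2)" for k
    by (simp add: batch_loss_def fun_eq_iff)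
  then have sm: "is_smooth L (batch_loss TYPE('m) A b S K k) \<longleftrightarrow> ?c * ?N k \<le> L" for k L
    using is_smooth_quadratic_iff [of ?c L "subsample (S k) A :: real^'d^'m"] c by simp
  have "{L. \<forall>k\<in>{1..K}. is_smooth L (batch_loss TYPE('m) A b S K k)} = {?c * Max (?N ` {1..K})..}"
  proof (intro set_eqI)
    fix L
    have "(\<forall>k\<in>{1..K}. ?c * ?N k \<le> L) \<longleftrightarrow> (\<forall>k\<in>{1..K}. ?N k \<le> L / ?c)"
      using c assms by (simp add: pos_le_divide_eq mult.commute field_simps)
    also have "\<dots> \<longleftrightarrow> Max (?N ` {1..K}) \<le> L / ?c"
      using assms by (subst Max_le_iff) auto
    also have "\<dots> \<longleftrightarrow> ?c * Max (?N ` {1..K}) \<le> L"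
      using pos_le_divide_eq [OF c, of "Max (?N ` {1..K})" L] by (simp only: mult.commute)
    finally show "L \<in> {L. \<forall>k\<in>{1..K}. is_smooth L (batch_loss TYPE('m) A b S K k)} \<longleftrightarrow>
        L \<in> {?c * Max (?N ` {1..K})..}"
      by (simp only: mem_Collect_eq sm atLeast_iff)
  qed
  then show ?thesis by (simp add: common_smooth_const_def spectral_norm_gram')
qed

lemma norm_sq_subsample:
  fixes v :: "real^'n"
  assumes "card S = CARD('m::finite)"
  shows "(norm (subsample S v :: real^'m))\<^sup>2 = (\<Sum>i\<in>S. (v $ i)\<^sup>2)"
proof -
  define e where "e = (SOME e. bij_betw e (UNIV :: 'm set) S)"
  have "\<exists>e. bij_betw e (UNIV :: 'm set) S"
    using assms by (intro finite_same_card_bij) auto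
  then have e: "bij_betw e (UNIV :: 'm set) S"
    unfolding e_def by (rule someI_ex)
  have "(norm (subsample S v :: real^'m))\<^sup>2 = (\<Sum>j\<in>UNIV. (v $ e j)\<^sup>2)"
    by (simp add: subsample_def e_def norm_vec_def L2_set_def sum_nonneg)
  also have "\<dots> = (\<Sum>i\<in>S. (v $ i)\<^sup>2)"
    using sum.reindex_bij_betw [OF e, of "\<lambda>i. (v $ i)\<^sup>2"] .
  finally show ?thesis .
qed

lemma least_squares_eq_average:
  fixes A :: "real^'d^'n"
  assumes "equipartition TYPE('m::finite) S K"
  shows "least_squares A b x = 1 / real K * (\<Sum>k\<in>{1..K}. batch_loss TYPE('m) A b S K k x)"
proof -
  have disj: "disjoint_family_on S {1..K}" and un: "(\<Union>k\<in>{1..K}. S k) = UNIV"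
    and cd: "\<And>k. k \<in> {1..K} \<Longrightarrow> card (S k) = CARD('m)"
    using assms by (auto simp: equipartition_def)
  have K: "K \<noteq> 0" using un by (cases K) auto
  let ?v = "A *v x - b"
  have sub: "(subsample T A :: real^'d^'m) *v x - subsample T b = subsample T ?v" for T
    by (simp add: subsample_def vec_eq_iff matrix_vector_mult_def)
  have "(norm ?v)\<^sup>2 = (\<Sum>i\<in>(\<Union>k\<in>{1..K}. S k). (?v $ i)\<^sup>2)"
    by (simp only: un) (simp add: norm_vec_def L2_set_def sum_nonneg)
  also have "\<dots> = (\<Sum>k\<in>{1..K}. \<Sum>i\<in>S k. (?v $ i)\<^sup>2)"
    using disj by (subst sum.UNION_disjoint) (auto simp: disjoint_family_on_def)
  also have "\<dots> = (\<Sum>k\<in>{1..K}. (norm (subsample (S k) ?v :: real^'m))\<^sup>2)"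
    by (intro sum.cong refl) (simp only: norm_sq_subsample cd)
  finally show ?thesis
    using K by (simp add: least_squares_def batch_loss_def sub
        flip: sum_distrib_left sum_divide_distrib)
qed

end

theory Submission
  imports Defs "HOL-Computational_Algebra.Fundamental_Theorem_Algebra"
begin

text \<open>
  Both smoothness constants are explicit, so the factor equals \<open>\<parallel>A\<parallel>\<^sup>2\<close> divided by the largest spectral
  norm of a minibatch Gram matrix. By the Schur test that norm is at most the largest absolute row
  sum of the Gram matrix, i.e. the local coherence, which Cauchy-Schwarz bounds by the batch size
  times the largest squared row norm. For the last inequality, the eigenvalues of \<open>A\<^sup>TA\<close> sum to its
  trace, which is the sum of the squared row norms. This needs all roots of the characteristic
  polynomial to be real: they exist over the complex numbers, are real by symmetry, and their sum
  is then read off the second-highest coefficient.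
\<close>

section \<open>Eigenvalues of a symmetric real matrix\<close>

lemma prod_linear_factors:
  fixes M :: "'a::idom multiset"
  shows "degree (\<Prod>a\<in>#M. [:-a, 1:]) = size M" (is ?deg)
    and "coeff (\<Prod>a\<in>#M. [:-a, 1:]) (size M) = 1" (is ?monic)
proof -
  have "?deg \<and> ?monic"
  proof (induction M)
    case (add a M)
    let ?P = "\<Prod>a\<in>#M. [:-a, 1:]"
    have "?P \<noteq> 0"
      using add.IH by force
    then have "degree ([:-a, 1:] * ?P) = Suc (size M)"
      using add.IH by (subst degree_mult_eq) auto
    moreover have "coeff ([:-a, 1:] * ?P) (Suc (size M)) = 1"
      using add.IH by (simp add: coeff_eq_0)
    ultimately show ?case
      by (simp del: mult_pCons_left)
  qed simp
  then show ?deg ?monic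
    by blast+
qed

text \<open>Vieta's formula: a further factor shifts this coefficient up and subtracts
  \<open>a\<close> times the leading coefficient 1. For the empty multiset,
  \<open>size M - 1\<close> truncates to 0, where the coefficient is 1 instead of 0.\<close>

lemma coeff_prod_linear_factors:
  fixes M :: "'a::idom multiset"
  assumes "M \<noteq> {#}"
  shows "coeff (\<Prod>a\<in>#M. [:-a, 1:]) (size M - 1) = - sum_mset M"
  using assms
proof (induction M)
  case (add a M)
  show ?case
  proof (cases "M = {#}")
    case False
    then obtain k where k: "size M = Suc k"
      by (metis Suc_pred size_eq_0_iff_empty gr0I)
    have "coeff (\<Prod>a\<in>#M. [:-a, 1:]) (Suc k) = 1"
      using prod_linear_factors(2) [of M] k by simp
    then show ?thesis
      using add.IH [OF False] k by simp
  qed simp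
qed simp

lemma map_poly_of_real_mult:
  "map_poly complex_of_real (p * q) = map_poly of_real p * map_poly of_real q"
  by (intro poly_eqI) (simp add: coeff_map_poly coeff_mult)

text \<open>Induction on the degree: the fundamental theorem of algebra gives a complex root, the
  hypothesis makes it real, and its linear factor is divided out over the reals. Roots of the
  quotient are roots of \<open>p\<close>, so the hypothesis is inherited.\<close>

lemma real_rooted_splits:
  fixes p :: "real poly"
  assumes "p \<noteq> 0" and "\<And>z. poly (map_poly complex_of_real p) z = 0 \<Longrightarrow> z \<in> \<real>"
  shows "smult (lead_coeff p) (\<Prod>a\<in>#proots p. [:-a, 1:]) = p"
  using assms
proof (induction "degree p" arbitrary: p)
  case 0
  then obtain c where "p = [:c:]"
    by (metis degree_eq_zeroE)
  then show ?case by simp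
next
  case (Suc n)
  let ?c = "map_poly complex_of_real"
  have "\<not> constant (poly (?c p))"
    using Suc.hyps(2) by (simp add: constant_degree degree_map_poly)
  then obtain z where z: "poly (?c p) z = 0"
    using fundamental_theorem_of_algebra by blast
  then obtain a where a: "z = complex_of_real a"
    using Suc.prems(2) by (metis Reals_cases)
  have "poly (?c r) (complex_of_real a) = complex_of_real (poly r a)" for r
    by (induction r) (simp_all add: map_poly_pCons)
  then have "poly p a = 0"
    using z a by simp
  then obtain q where q: "p = [:-a, 1:] * q"
    using poly_eq_0_iff_dvd by (metis dvdE)
  have q0: "q \<noteq> 0" using q Suc.prems(1) by auto
  have "degree p = Suc (degree q)"
    unfolding q using q0 by (subst degree_mult_eq) auto
  then have dq: "n = degree q" using Suc.hyps(2) by simp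
  have "w \<in> \<real>" if "poly (?c q) w = 0" for w
  proof -
    have "?c p = ?c [:-a, 1:] * ?c q"
      unfolding q by (rule map_poly_of_real_mult)
    then show ?thesis
      using Suc.prems(2) [of w] that by (simp only: poly_mult mult_zero_right)
  qed
  then have IH: "smult (lead_coeff q) (\<Prod>a\<in>#proots q. [:-a, 1:]) = q"
    using Suc.hyps(1) [OF dq q0] by blast
  have pr: "proots p = add_mset a (proots q)"
    unfolding q using q0 by (subst proots_mult) auto
  have "lead_coeff p = lead_coeff q"
    unfolding q by (subst lead_coeff_mult) simp
  then have "smult (lead_coeff p) (\<Prod>a\<in>#proots p. [:-a, 1:])
      = [:-a, 1:] * smult (lead_coeff q) (\<Prod>a\<in>#proots q. [:-a, 1:])"
    by (simp only: pr image_mset_add_mset prod_mset.add_mset mult_smult_right)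
  then show ?case by (simp only: IH q [symmetric])
qed

section \<open>The characteristic polynomial of a symmetric matrix\<close>

lemma charpoly_complex_root_real:
  fixes H :: "real^'n^'n"
  assumes sym: "transpose H = H" and z: "poly (map_poly complex_of_real (charpoly H)) z = 0"
  shows "z \<in> \<real>"
proof -
  define C :: "complex^'n^'n" where "C = (\<chi> i j. complex_of_real (H $ i $ j))"
  \<comment> \<open>Embedding the coefficients is a ring homomorphism, so it commutes with the
    Leibniz expansion of the determinant.\<close>
  have *: "map_poly complex_of_real (charpoly H) =
      det (\<chi> i j. map_poly complex_of_real ((if i = j then [:0, 1:] else 0) - [:H $ i $ j:]))"
  proof -
    have sum: "map_poly complex_of_real (sum f X) = (\<Sum>x\<in>X. map_poly of_real (f x))"
      for f :: "('n \<Rightarrow> 'n) \<Rightarrow> real poly" and X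
      by (intro poly_eqI) (simp add: coeff_map_poly coeff_sum)
    have prod: "map_poly complex_of_real (prod f X) = (\<Prod>x\<in>X. map_poly of_real (f x))"
      for f :: "'n \<Rightarrow> real poly" and X
      by (induction X rule: infinite_finite_induct) (simp_all add: map_poly_of_real_mult)
    have sgn: "map_poly complex_of_real (of_int k) = of_int k" for k
      by (intro poly_eqI) (simp add: coeff_map_poly of_int_poly coeff_pCons split: nat.split)
    show ?thesis
      by (simp add: charpoly_def det_def sum map_poly_of_real_mult prod sgn)
  qed
  have "poly (map_poly complex_of_real (charpoly H)) z = det (mat z - C)"
  proof -
    have "poly (map_poly complex_of_real ((if i = j then [:0, 1:] else 0) - [:H $ i $ j:])) z
        = (mat z - C) $ i $ j" for i j
      by (simp add: C_def mat_def map_poly_pCons)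
    then show ?thesis
      by (simp add: * det_def poly_sum poly_prod)
  qed
  then have "\<not> invertible (mat z - C)"
    using z by (simp add: invertible_det_nz)
  then obtain v where v: "v \<noteq> 0" "(mat z - C) *v v = 0"
    by (metis invertible_left_inverse matrix_left_invertible_ker)
  have Cv: "(\<Sum>j\<in>UNIV. of_real (H $ i $ j) * v $ j) = z * v $ i" for i
  proof -
    have "((mat z - C) *v v) $ i = (\<Sum>j\<in>UNIV. (if i = j then z * v $ j else 0))
        - (\<Sum>j\<in>UNIV. of_real (H $ i $ j) * v $ j)"
      unfolding sum_subtractf [symmetric] matrix_vector_mult_def
      by (auto simp: C_def mat_def algebra_simps intro!: sum.cong)
    then show ?thesis using v by simp
  qed
  let ?N = "\<Sum>i\<in>UNIV. v $ i * cnj (v $ i)"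
  \<comment> \<open>\<open>T\<close> is the Hermitian form of \<open>H\<close> at \<open>v\<close>, which is real.\<close>
  define T where "T = (\<Sum>i\<in>UNIV. \<Sum>j\<in>UNIV. of_real (H $ i $ j) * v $ j * cnj (v $ i))"
  \<comment> \<open>The eigenvector equation \<open>Cv\<close> exhibits \<open>z\<close> as a
    quotient of \<open>T\<close> and the squared norm \<open>?N\<close> of \<open>v\<close>. Both
    are real and \<open>?N\<close> is nonzero, so \<open>z\<close> is real.\<close>
  have T: "T = z * ?N"
    unfolding T_def sum_distrib_right [symmetric] Cv by (simp add: sum_distrib_left mult.assoc)
  have Hs: "H $ i $ j = H $ j $ i" for i j
    using sym by (metis transpose_def vec_lambda_beta)
  have "cnj T = (\<Sum>i\<in>UNIV. \<Sum>j\<in>UNIV. of_real (H $ i $ j) * cnj (v $ j) * v $ i)"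
    by (simp add: T_def)
  also have "\<dots> = (\<Sum>j\<in>UNIV. \<Sum>i\<in>UNIV. of_real (H $ i $ j) * cnj (v $ j) * v $ i)"
    by (rule sum.swap)
  also have "\<dots> = T"
    unfolding T_def by (intro sum.cong refl) (simp add: Hs mult_ac)
  finally have "cnj T = T" .
  have N: "?N = of_real (\<Sum>i\<in>UNIV. (cmod (v $ i))\<^sup>2)"
    by (simp only: of_real_sum complex_norm_square)
  obtain i where "v $ i \<noteq> 0"
    using v(1) by (metis vec_eq_iff zero_index)
  then have "(\<Sum>i\<in>UNIV. (cmod (v $ i))\<^sup>2) > 0"
    by (intro sum_pos2 [of _ i]) auto
  then have "?N \<noteq> 0" "cnj ?N = ?N"
    unfolding N by (simp_all only: of_real_eq_0_iff complex_cnj_complex_of_real)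
  then have "cnj z = z"
    using T \<open>cnj T = T\<close> by (metis complex_cnj_mult mult_right_cancel)
  then show ?thesis
    by (simp add: Reals_cnj_iff)
qed

lemma charpoly_top_coeffs:
  fixes H :: "real^'n^'n"
  assumes "k \<ge> CARD('n) - 1"
  shows "coeff (charpoly H) k = coeff (\<Prod>i\<in>UNIV. [:- H $ i $ i, 1:]) k"
proof -
  define M :: "real poly^'n^'n"
    where "M = (\<chi> i j. (if i = j then [:0, 1:] else 0) - [:H $ i $ j:])"
  let ?P = "{p. p permutes (UNIV :: 'n set)}"
  let ?t = "\<lambda>p. of_int (sign p) * (\<Prod>i\<in>UNIV. M $ i $ p i)"
  have count: "(\<Sum>j\<in>UNIV. if j \<in> X then 1 else 0) = card X" for X :: "'n set"
    by (simp add: sum.If_cases)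
  \<comment> \<open>A permutation other than the identity moves at least two indices, hence meets the diagonal,
    the only place where the indeterminate occurs, at most \<open>CARD('n) - 2\<close> times.\<close>
  have off_id: "coeff (?t p) k = 0" if p: "p permutes UNIV" "p \<noteq> id" for p
  proof -
    obtain i where i: "p i \<noteq> i"
      using p(2) by (auto simp: fun_eq_iff)
    \<comment> \<open>By injectivity \<open>p i\<close> is a second moved index. The factors at
      \<open>i\<close> and \<open>p i\<close> are constants, and every other factor has degree at
      most 1.\<close>
    have pp: "p (p i) \<noteq> p i"
      using i permutes_inj [OF p(1)] by (metis injD)
    have "degree (\<Prod>i\<in>UNIV. M $ i $ p i) \<le> (\<Sum>i\<in>UNIV. degree (M $ i $ p i))"
      using degree_prod_sum_le [of UNIV "\<lambda>i. M $ i $ p i"] by (simp add: o_def)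
    also have "\<dots> \<le> (\<Sum>j\<in>UNIV. if j \<in> - {i, p i} then 1 else 0)"
      using i pp by (intro sum_mono) (auto simp: M_def)
    also have "\<dots> = card (- {i, p i})"
      using count [of "- {i, p i}"] .
    also have "\<dots> = CARD('n) - 2"
      using i by (simp add: Compl_eq_Diff_UNIV card_Diff_subset)
    finally have "degree (\<Prod>i\<in>UNIV. M $ i $ p i) \<le> CARD('n) - 2" .
    \<comment> \<open>There are at least two indices, so \<open>CARD('n) - 2\<close> does not
      truncate and lies strictly below \<open>CARD('n) - 1\<close>.\<close>
    moreover have "card {i, p i} \<le> CARD('n)"
      by (intro card_mono) auto
    ultimately have "degree (\<Prod>i\<in>UNIV. M $ i $ p i) < k"
      using i assms by simp
    then have "coeff (\<Prod>i\<in>UNIV. M $ i $ p i) k = 0"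
      by (rule coeff_eq_0)
    then show ?thesis
      by (simp add: sign_def)
  qed
  have "coeff (charpoly H) k = (\<Sum>p\<in>?P. coeff (?t p) k)"
    by (simp add: charpoly_def det_def M_def coeff_sum)
  also have "\<dots> = (\<Sum>p\<in>{id}. coeff (?t p) k)"
    by (rule sum.mono_neutral_right) (auto simp: finite_permutations permutes_id off_id)
  also have "\<dots> = coeff (\<Prod>i\<in>UNIV. [:- H $ i $ i, 1:]) k"
    by (simp add: M_def)
  finally show ?thesis .
qed

text \<open>From index \<open>CARD('n) - 1\<close> upwards the coefficients are those of the product
  of linear factors over the diagonal multiset \<open>D\<close>, to which Vieta's formula
  applies.\<close>

lemma charpoly_degree_and_trace:
  fixes H :: "real^'n^'n"
  shows "degree (charpoly H) = CARD('n)" and "lead_coeff (charpoly H) = 1"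
    and "coeff (charpoly H) (CARD('n) - 1) = - trace H"
proof -
  define D where "D = image_mset (\<lambda>i. H $ i $ i) (mset_set (UNIV :: 'n set))"
  have P: "(\<Prod>i\<in>UNIV. [:- H $ i $ i, 1:]) = (\<Prod>a\<in>#D. [:-a, 1:])"
    by (simp add: D_def prod_unfold_prod_mset image_mset.compositionality o_def)
  have sz: "size D = CARD('n)" by (simp add: D_def)
  then have "D \<noteq> {#}" by auto
  have top: "coeff (charpoly H) k = coeff (\<Prod>a\<in>#D. [:-a, 1:]) k" if "k \<ge> CARD('n) - 1" for k
    using charpoly_top_coeffs [OF that, of H] P by simp
  have "coeff (charpoly H) (CARD('n)) = 1"
    using top [of "CARD('n)"] prod_linear_factors(2) [of D] sz by simp
  moreover have "coeff (charpoly H) k = 0" if "k > CARD('n)" for k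
    using top [of k] prod_linear_factors(1) [of D] sz that by (simp add: coeff_eq_0)
  ultimately show deg: "degree (charpoly H) = CARD('n)"
    by (intro antisym degree_le le_degree) auto
  then show "lead_coeff (charpoly H) = 1"
    using \<open>coeff (charpoly H) (CARD('n)) = 1\<close> by simp
  show "coeff (charpoly H) (CARD('n) - 1) = - trace H"
    using top [of "CARD('n) - 1"] coeff_prod_linear_factors [OF \<open>D \<noteq> {#}\<close>] sz
    by (simp add: D_def trace_def sum_unfold_sum_mset)
qed

text \<open>All complex roots being real, the polynomial splits over the reals and
  \<open>proots\<close> misses none of them. Degree and second-highest coefficient of the split form
  are then compared with those of \<open>charpoly H\<close>.\<close>

lemma symmetric_proots_charpoly:
  fixes H :: "real^'n^'n"
  assumes "transpose H = H"
  shows "size (proots (charpoly H)) = CARD('n)" and "sum_mset (proots (charpoly H)) = trace H"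
proof -
  have "charpoly H \<noteq> 0"
    using charpoly_degree_and_trace(2) [of H] by auto
  then have split: "(\<Prod>a\<in>#proots (charpoly H). [:-a, 1:]) = charpoly H"
    using real_rooted_splits [of "charpoly H"] charpoly_complex_root_real [OF assms]
      charpoly_degree_and_trace(2) [of H] by simp
  then show size: "size (proots (charpoly H)) = CARD('n)"
    using prod_linear_factors(1) [of "proots (charpoly H)"] charpoly_degree_and_trace(1) [of H]
    by simp
  then have "proots (charpoly H) \<noteq> {#}" by auto
  from coeff_prod_linear_factors [OF this] show "sum_mset (proots (charpoly H)) = trace H"
    using charpoly_degree_and_trace(3) [of H] by (simp add: split size)
qed

section \<open>Eigenvalues in descending order\<close>

lemma sum_eigval_desc:
  fixes H :: "real^'n^'n"
  assumes "transpose H = H"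
  shows "(\<Sum>i = 1..CARD('n). eigval_desc H i) = trace H"
proof -
  define xs where "xs = rev (sorted_list_of_multiset (proots (charpoly H)))"
  have mset: "mset xs = proots (charpoly H)"
    by (simp add: xs_def)
  then have len: "length xs = CARD('n)"
    using symmetric_proots_charpoly(1) [OF assms] by (metis size_mset)
  \<comment> \<open>Eigenvalues are numbered from 1, list positions from 0.\<close>
  have "(\<Sum>i = 1..CARD('n). eigval_desc H i) = (\<Sum>i<CARD('n). xs ! i)"
    by (rule sum.reindex_bij_witness [of _ Suc "\<lambda>i. i - 1"]) (auto simp: eigval_desc_def xs_def)
  also have "\<dots> = sum_list xs"
    by (simp add: sum_list_sum_nth len atLeast0LessThan)
  also have "\<dots> = trace H"
    using symmetric_proots_charpoly(2) [OF assms] by (metis mset sum_mset_sum_list)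
  finally show ?thesis .
qed

text \<open>The list of roots has length \<open>CARD('n)\<close>, so position \<open>k - 1\<close>
  holds a genuine root of the characteristic polynomial; its eigenvector gives the bound.\<close>

lemma eigval_desc_le_spectral_norm:
  fixes H :: "real^'n^'n"
  assumes "transpose H = H" and "1 \<le> k" and "k \<le> CARD('n)"
  shows "eigval_desc H k \<le> spectral_norm H"
proof -
  define xs where "xs = rev (sorted_list_of_multiset (proots (charpoly H)))"
  have mset: "mset xs = proots (charpoly H)"
    by (simp add: xs_def)
  then have "length xs = CARD('n)"
    using symmetric_proots_charpoly(1) [OF assms(1)] by (metis size_mset)
  then have "eigval_desc H k \<in> set xs"
    using assms unfolding eigval_desc_def xs_def [symmetric] by (intro nth_mem) auto
  then have "eigval_desc H k \<in># proots (charpoly H)"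
    by (simp flip: mset)
  moreover have "charpoly H \<noteq> 0"
    using charpoly_degree_and_trace(2) [of H] by auto
  ultimately obtain v where v: "v \<noteq> 0" "H *v v = eigval_desc H k *\<^sub>R v"
    by (auto simp: charpoly_root_iff)
  have "\<bar>eigval_desc H k\<bar> * norm v \<le> spectral_norm H * norm v"
    using norm_mult_le_spectral_norm [of H v] v by simp
  then show ?thesis
    using v(1) by simp
qed

section \<open>Gram matrices of minibatches\<close>

lemma trace_gram: "trace (transpose A ** A) = (\<Sum>j\<in>UNIV. (norm (row j A))\<^sup>2)"
  for A :: "real^'d^'n"
proof -
  have "trace (transpose A ** A) = (\<Sum>i\<in>UNIV. \<Sum>j\<in>UNIV. (A $ j $ i)\<^sup>2)"
    by (simp add: trace_def matrix_matrix_mult_def transpose_def power2_eq_square)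
  also have "\<dots> = (\<Sum>j\<in>UNIV. \<Sum>i\<in>UNIV. (A $ j $ i)\<^sup>2)"
    by (rule sum.swap)
  also have "\<dots> = (\<Sum>j\<in>UNIV. (norm (row j A))\<^sup>2)"
    by (simp add: row_def norm_vec_def L2_set_def sum_nonneg)
  finally show ?thesis .
qed

lemma spectral_norm_eq_0_iff: "spectral_norm A = 0 \<longleftrightarrow> A = 0"
  for A :: "real^'d^'n"
  unfolding spectral_norm_def
  by (simp add: onorm_eq_0 matrix_vector_mul_bounded_linear matrix_eq)

text \<open>Schur test: with each \<open>\<bar>G $ i $ j\<bar>\<close> split into two square roots,
  Cauchy-Schwarz bounds every coordinate of \<open>G *v x\<close> at the cost of one row sum.
  Summing the squares costs one column sum, whence \<open>M\<^sup>2\<close>.\<close>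

lemma schur_test_symmetric:
  fixes G :: "real^'n^'n"
  assumes sym: "transpose G = G" and M: "\<And>i. (\<Sum>j\<in>UNIV. \<bar>G $ i $ j\<bar>) \<le> M"
  shows "spectral_norm G \<le> M"
  unfolding spectral_norm_def
proof (rule onorm_le)
  fix x
  have Gs: "G $ i $ j = G $ j $ i" for i j
    using sym by (metis transpose_def vec_lambda_beta)
  \<comment> \<open>\<open>undefined\<close> serves as an arbitrary row index.\<close>
  have M0: "0 \<le> M"
    using M [of undefined] by (meson order_trans sum_nonneg abs_ge_zero)
  have row: "((G *v x) $ i)\<^sup>2 \<le> M * (\<Sum>j\<in>UNIV. \<bar>G $ i $ j\<bar> * (x $ j)\<^sup>2)" for i
  proof -
    have "\<bar>(G *v x) $ i\<bar> \<le> (\<Sum>j\<in>UNIV. \<bar>G $ i $ j * x $ j\<bar>)"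
      unfolding matrix_vector_mult_def vec_lambda_beta by (rule sum_abs)
    also have "\<dots> = (\<Sum>j\<in>UNIV. sqrt \<bar>G $ i $ j\<bar> * (sqrt \<bar>G $ i $ j\<bar> * \<bar>x $ j\<bar>))"
      by (simp only: abs_mult mult.assoc [symmetric] real_sqrt_mult_self abs_abs)
    finally have "\<bar>(G *v x) $ i\<bar> \<le> (\<Sum>j\<in>UNIV. sqrt \<bar>G $ i $ j\<bar> * (sqrt \<bar>G $ i $ j\<bar> * \<bar>x $ j\<bar>))" .
    from power_mono [OF this abs_ge_zero, of 2] have "((G *v x) $ i)\<^sup>2
        \<le> (\<Sum>j\<in>UNIV. sqrt \<bar>G $ i $ j\<bar> * (sqrt \<bar>G $ i $ j\<bar> * \<bar>x $ j\<bar>))\<^sup>2"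
      by (simp only: power2_abs)
    also have "\<dots> \<le> (\<Sum>j\<in>UNIV. (sqrt \<bar>G $ i $ j\<bar>)\<^sup>2) * (\<Sum>j\<in>UNIV. (sqrt \<bar>G $ i $ j\<bar> * \<bar>x $ j\<bar>)\<^sup>2)"
      by (rule Cauchy_Schwarz_ineq_sum)
    also have "\<dots> = (\<Sum>j\<in>UNIV. \<bar>G $ i $ j\<bar>) * (\<Sum>j\<in>UNIV. \<bar>G $ i $ j\<bar> * (x $ j)\<^sup>2)"
      by (simp add: power_mult_distrib)
    also have "\<dots> \<le> M * (\<Sum>j\<in>UNIV. \<bar>G $ i $ j\<bar> * (x $ j)\<^sup>2)"
      by (intro mult_right_mono M sum_nonneg) auto
    finally show ?thesis .
  qed
  have "(norm (G *v x))\<^sup>2 = (\<Sum>i\<in>UNIV. ((G *v x) $ i)\<^sup>2)"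
    by (simp add: norm_vec_def L2_set_def sum_nonneg)
  also have "\<dots> \<le> (\<Sum>i\<in>UNIV. M * (\<Sum>j\<in>UNIV. \<bar>G $ i $ j\<bar> * (x $ j)\<^sup>2))"
    by (intro sum_mono row)
  also have "\<dots> = M * (\<Sum>j\<in>UNIV. \<Sum>i\<in>UNIV. \<bar>G $ i $ j\<bar> * (x $ j)\<^sup>2)"
    by (subst sum.swap) (simp add: sum_distrib_left)
  \<comment> \<open>Symmetry turns the column sums into row sums, so the bound \<open>M\<close>
    applies a second time.\<close>
  also have "\<dots> = M * (\<Sum>j\<in>UNIV. (\<Sum>i\<in>UNIV. \<bar>G $ j $ i\<bar>) * (x $ j)\<^sup>2)"
    by (simp add: sum_distrib_right Gs)
  also have "\<dots> \<le> M * (\<Sum>j\<in>UNIV. M * (x $ j)\<^sup>2)"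
    by (intro mult_left_mono sum_mono mult_right_mono M M0) auto
  also have "\<dots> = M\<^sup>2 * (\<Sum>j\<in>UNIV. (x $ j)\<^sup>2)"
    by (simp only: sum_distrib_left [symmetric] power2_eq_square mult.assoc)
  also have "\<dots> = (M * norm x)\<^sup>2"
    by (simp add: norm_vec_def L2_set_def sum_nonneg power_mult_distrib)
  finally show "norm (G *v x) \<le> M * norm x"
    by (rule power2_le_imp_le) (simp add: M0)
qed

section \<open>Spectral norms of the minibatch Gram matrices\<close>

lemma subsample_enum:
  assumes "card S = CARD('m::finite)"
  obtains e where "bij_betw e (UNIV :: 'm set) S"
    and "\<And>v :: 'a^'n. (subsample S v :: 'a^'m) = (\<chi> j. v $ e j)"
proof
  show "bij_betw (SOME e. bij_betw e (UNIV :: 'm set) S) UNIV S"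
    using assms by (intro someI_ex [where P = "\<lambda>e. bij_betw e UNIV S"] finite_same_card_bij) auto
qed (simp add: subsample_def)

text \<open>The enumeration \<open>e\<close> carries the row sums of the Gram matrix to the
  coherence sums over \<open>S\<close>, whatever its order, and the Schur test applies.\<close>

lemma spectral_norm_subsample_gram_le:
  fixes A :: "real^'d^'n"
  assumes card: "card S = CARD('m::finite)"
    and M: "\<And>j. j \<in> S \<Longrightarrow> (\<Sum>k\<in>S. \<bar>row j A \<bullet> row k A\<bar>) \<le> M"
  shows "spectral_norm ((subsample S A :: real^'d^'m) ** transpose (subsample S A :: real^'d^'m)) \<le> M"
proof -
  obtain e where e: "bij_betw e (UNIV :: 'm set) S"
    and B: "(subsample S A :: real^'d^'m) = (\<chi> j. A $ e j)"
    using subsample_enum [OF card] by metis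
  let ?B = "subsample S A :: real^'d^'m"
  have entry: "(?B ** transpose ?B) $ i $ j = row (e i) A \<bullet> row (e j) A" for i j
    by (simp add: B matrix_matrix_mult_def transpose_def row_def inner_vec_def)
  show ?thesis
  proof (rule schur_test_symmetric)
    show "transpose (?B ** transpose ?B) = ?B ** transpose ?B"
      by (simp add: matrix_transpose_mul)
    fix i
    have "e i \<in> S" using e by (auto simp: bij_betw_def)
    moreover have "(\<Sum>j\<in>UNIV. \<bar>row (e i) A \<bullet> row (e j) A\<bar>) = (\<Sum>k\<in>S. \<bar>row (e i) A \<bullet> row k A\<bar>)"
      by (rule sum.reindex_bij_betw [OF e])
    ultimately show "(\<Sum>j\<in>UNIV. \<bar>(?B ** transpose ?B) $ i $ j\<bar>) \<le> M"
      using M [of "e i"] by (simp add: entry)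
  qed
qed

text \<open>This makes the denominator of the acceleration factor positive: a nonzero row of
  \<open>A\<close> survives in its batch, and the norm here is the square of that of the
  batch.\<close>

lemma spectral_norm_subsample_gram_pos:
  fixes A :: "real^'d^'n"
  assumes card: "card S = CARD('m::finite)" and j: "j \<in> S" "row j A \<noteq> 0"
  shows "spectral_norm ((subsample S A :: real^'d^'m) ** transpose (subsample S A :: real^'d^'m)) > 0"
proof -
  obtain e where e: "bij_betw e (UNIV :: 'm set) S"
    and B: "(subsample S A :: real^'d^'m) = (\<chi> j. A $ e j)"
    using subsample_enum [OF card] by metis
  obtain i where "j = e i"
    using e j(1) by (auto simp: bij_betw_def)
  then have "(subsample S A :: real^'d^'m) $ i \<noteq> 0"
    using j(2) by (simp add: B row_def)
  then have "(subsample S A :: real^'d^'m) \<noteq> 0"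
    by auto
  then show ?thesis
    by (simp add: spectral_norm_gram' spectral_norm_eq_0_iff)
qed

section \<open>The chain of inequalities\<close>

theorem theorem4p13:
  fixes A :: "real^'d^'n" and b :: "real^'n"
    and S :: "nat \<Rightarrow> 'n set" and K :: nat and \<rho> :: real
  assumes "A \<noteq> 0"
    and "equipartition TYPE('m::finite) S K"
    and "1 \<le> \<rho>" and "\<rho> \<le> real CARD('n)"
    and "(MAX i\<in>UNIV. (norm (row i A))\<^sup>2) / (1 / real CARD('n) * (\<Sum>j\<in>UNIV. (norm (row j A))\<^sup>2)) \<le> \<rho>"
  shows "SA_factor TYPE('m) A b S K \<ge> (spectral_norm A)\<^sup>2 / local_coherence A S K
    \<and> (spectral_norm A)\<^sup>2 / local_coherence A S K
        \<ge> real K * (spectral_norm A)\<^sup>2 / (real CARD('n) * sq_norm_transpose_1_to_2 A)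
    \<and> real K * (spectral_norm A)\<^sup>2 / (real CARD('n) * sq_norm_transpose_1_to_2 A)
        \<ge> real K * eigval_desc (transpose A ** A) 1
            / (\<rho> * (\<Sum>i = 1..CARD('d). eigval_desc (transpose A ** A) i))"
proof -
  let ?n = "real CARD('n)" and ?m = "real CARD('m)"
  let ?mu = "local_coherence A S K" and ?R = "sq_norm_transpose_1_to_2 A"
  let ?g = "\<lambda>k. spectral_norm ((subsample (S k) A :: real^'d^'m) **
                                     transpose (subsample (S k) A :: real^'d^'m))"
  define L where "L = (MAX k\<in>{1..K}. ?g k)"
  have un: "(\<Union>k\<in>{1..K}. S k) = UNIV"
    and cd: "\<And>k. k \<in> {1..K} \<Longrightarrow> card (S k) = CARD('m)" and mn: "?m = ?n / real K"
    using assms(2) by (auto simp: equipartition_def)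
  have K: "K \<ge> 1" using un by (cases K) auto
  have R: "(norm (row i A))\<^sup>2 \<le> ?R" for i
    unfolding sq_norm_transpose_1_to_2_def by (rule Max_ge) auto
  have coh: "(\<Sum>k\<in>S q. \<bar>row j A \<bullet> row k A\<bar>) \<le> ?mu" if "q \<in> {1..K}" "j \<in> S q" for q j
  proof -
    have "(\<Sum>k\<in>S q. \<bar>row j A \<bullet> row k A\<bar>) \<le> (MAX j\<in>S q. \<Sum>k\<in>S q. \<bar>row j A \<bullet> row k A\<bar>)"
      using that by (intro Max_ge) auto
    also have "\<dots> \<le> ?mu"
      unfolding local_coherence_def using that by (intro Max_ge) auto
    finally show ?thesis .
  qed
  \<comment> \<open>This row makes all denominators positive: \<open>L\<close> and
    \<open>?mu\<close> through its batch \<open>q\<close>, and later \<open>?F\<close> and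
    \<open>?R\<close>.\<close>
  obtain j where j: "row j A \<noteq> 0"
    using assms(1) by (metis row_def vec_eq_iff vec_lambda_eta zero_index)
  obtain q where q: "q \<in> {1..K}" "j \<in> S q"
    using un by blast
  have "0 < ?g q"
    by (rule spectral_norm_subsample_gram_pos [OF cd [OF q(1)] q(2) j])
  also have "?g q \<le> L"
    unfolding L_def using q by (intro Max_ge) auto
  finally have L: "L > 0" .
  have Lmu: "L \<le> ?mu"
    unfolding L_def using K by (auto intro!: Max.boundedI spectral_norm_subsample_gram_le cd coh)
  \<comment> \<open>The common constant is \<open>real K / ?n * L\<close>; its prefactor cancels
    against \<open>K\<close> and \<open>1 / ?n\<close> in the numerator.\<close>
  have SA: "SA_factor TYPE('m) A b S K = (spectral_norm A)\<^sup>2 / L"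
    unfolding SA_factor_def smooth_const_least_squares common_smooth_const_batch_loss [OF K]
      L_def [symmetric]
    using K by simp
  have muR: "?mu \<le> ?m * ?R"
  proof -
    have "(\<Sum>k\<in>S p. \<bar>row i A \<bullet> row k A\<bar>) \<le> ?m * ?R" if "p \<in> {1..K}" for p i
    proof -
      have "\<bar>row i A \<bullet> row k A\<bar> \<le> ?R" for k
      proof -
        have "\<bar>row i A \<bullet> row k A\<bar> \<le> norm (row i A) * norm (row k A)"
          by (rule Cauchy_Schwarz_ineq2)
        also have "\<dots> \<le> sqrt ?R * sqrt ?R"
          using R by (intro mult_mono real_le_rsqrt) (auto intro: order_trans [OF _ R])
        also have "\<dots> = ?R"
          using order_trans [OF zero_le_power2 R] by simp
        finally show ?thesis .
      qed
      then show ?thesis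
        using sum_bounded_above [of "S p" "\<lambda>k. \<bar>row i A \<bullet> row k A\<bar>" ?R] cd [OF that] by simp
    qed
    moreover have "S p \<noteq> {}" if "p \<in> {1..K}" for p
      using cd [OF that] by auto
    ultimately show ?thesis
      unfolding local_coherence_def using K by (intro Max.boundedI) (auto intro!: Max.boundedI)
  qed
  have mu: "?mu > 0" using L Lmu by simp
  have one: "(spectral_norm A)\<^sup>2 / ?mu \<le> SA_factor TYPE('m) A b S K"
    unfolding SA using L Lmu by (intro divide_left_mono) auto
  \<comment> \<open>Since \<open>?m\<close> is \<open>?n / real K\<close>, the third term of the
    chain has the bound of \<open>muR\<close> as its denominator.\<close>
  have "real K * (spectral_norm A)\<^sup>2 / (?n * ?R) = (spectral_norm A)\<^sup>2 / (?m * ?R)"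
    using K by (simp add: mn)
  also have "\<dots> \<le> (spectral_norm A)\<^sup>2 / ?mu"
    using mu muR by (intro divide_left_mono) auto
  finally have two: "real K * (spectral_norm A)\<^sup>2 / (?n * ?R) \<le> (spectral_norm A)\<^sup>2 / ?mu" .
  let ?H = "transpose A ** A" and ?F = "\<Sum>j\<in>UNIV. (norm (row j A))\<^sup>2"
  have sym: "transpose ?H = ?H"
    by (simp add: matrix_transpose_mul)
  have sum: "(\<Sum>i = 1..CARD('d). eigval_desc ?H i) = ?F"
    using sum_eigval_desc [OF sym] by (simp only: trace_gram)
  have F: "?F > 0"
    using j by (intro sum_pos2 [of _ j]) auto
  have "?R > 0"
    using R [of j] j by (smt (verit) zero_less_norm_iff zero_less_power)
  \<comment> \<open>The hypothesis on \<open>\<rho>\<close> with its denominator, positive by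
    \<open>F\<close>, cleared.\<close>
  have nR: "?n * ?R \<le> \<rho> * ?F"
    using assms(5) F unfolding sq_norm_transpose_1_to_2_def [symmetric]
    by (simp add: field_simps)
  \<comment> \<open>The norm of \<open>?H\<close> is the square of that of \<open>A\<close>. With
    \<open>nR\<close>, the last fraction has the smaller numerator and the larger
    denominator.\<close>
  have "eigval_desc ?H 1 \<le> (spectral_norm A)\<^sup>2"
    using eigval_desc_le_spectral_norm [OF sym, of 1] by (simp add: spectral_norm_gram Suc_le_eq)
  then have three: "real K * eigval_desc ?H 1 / (\<rho> * ?F) \<le> real K * (spectral_norm A)\<^sup>2 / (?n * ?R)"
    using nR \<open>?R > 0\<close> by (intro frac_le mult_left_mono) auto
  show ?thesis
    using one two three sum by simp
qed

end
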